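(* For every $n$, the evaluation map $ev_n:\mathrm{Emb}^{fr}(\mathbb R,\mathbb R^3)\to AM_n^{fr}$ is a map of $\mathcal C_1$-spaces, i.e. it commutes with the actions of the little intervals operad $\mathcal C_1$ on $\mathrm{Emb}^{fr}(\mathbb R,\mathbb R^3)$ and on $AM_n^{fr}$.
   Context: $I=[-1,1]$, $e_1=(1,0,0)$, $y_0=(-1,0,0)$, $y_1=(1,0,0)$, $\Delta^n=\{t=(t_1,\dots,t_n):-1\le t_1\le\dots\le t_n\le 1\}$, with $t_0=-1$, $t_{n+1}=1$. $C_m\langle I^3\rangle$ is the closure in $(I^3)^m\times (S^2)^{\binom m2}$ of the set of all $((x_a)_a,(v_{ab})_{a<b})$ with the $x_a\in I^3$ distinct and $v_{ab}=(x_b-x_a)/|x_b-x_a|$. $C_n^{fr}\langle I^3,\partial\rangle$ is the space of $((x_a)_{0\le a\le n+1},(v_{ab})_{a<b},(\alpha_a)_{0\le a\le n+1})$ with $((x_a),(v_{ab}))\in C_{n+2}\langle I^3\rangle$, $\alpha_a\in O(3)$, $x_0=y_0$, $x_{n+1}=y_1$, $\alpha_0=\alpha_{n+1}=\mathrm{id}$. For $0\le i\le n$ the doubling map $d^i:C_{n-1}^{fr}\langle I^3,\partial\rangle\to C_n^{fr}\langle I^3,\partial\rangle$ replaces the $i$-th point by two consecutive points with the same position, the same frame $\alpha_i$, the same directions to all other points, and direction $\alpha_i e_1$ from the first to the second. $AM_n^{fr}$ is the homotopy limit over the poset of nonempty subsets $S\subseteq\{0,\dots,n\}$ of the diagram $S\mapsto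 C^{fr}_{\#S-1}\langle I^3,\partial\rangle$ formed from the doubling maps; concretely it is the subspace of $\mathrm{Map}(\Delta^n,C_n^{fr}\langle I^3,\partial\rangle)$ of all $\phi$ such that $\phi(t)\in\mathrm{im}(d^i)$ whenever $t_i=t_{i+1}$, $0\le i\le n$. $\mathrm{Emb}^{fr}(\mathbb R,\mathbb R^3)$ consists of pairs $(f,\alpha)$ of a smooth embedding $f:\mathbb R\to\mathbb R^3$ with $f(I)\subset I^3$ and $f(t)=(t,0,0)$ for $t\notin I$, and a smooth $\alpha:\mathbb R\to O(3)$ whose first column is $f'/|f'|$ and which is $\mathrm{id}$ outside $I$. $ev_n(f,\alpha)$ sends $t\in\Delta^n$ to the configuration with positions $f(t_a)$, frames $\alpha(t_a)$ and directions $v_{ab}=(f(t_b)-f(t_a))/|f(t_b)-f(t_a)|$ if $t_a\ne t_b$, $v_{ab}=f'(t_a)/|f'(t_a)|$ if $t_a=t_b$. $\mathcal C_1(k)$ is the space of $k$-tuples $(L_1,\dots,L_k)$ of pairwise disjoint closed subintervals of $I$ (topologized by endpoints), with the usual operad structure. For an interval $L$, let $L:I\to L$ also denote the increasing affine bijection, $\widehat L:I^3\to I^3$ (and likewise $\mathbb R^3\to\mathbb R^3$) the map applying $L$ to the first coordinate and scaling the other two by the same factor without translation, and $\kappa_L:I\to I$ the map equal to $L^{-1}$ on $L$, $-1$ to the left of $L$ and $1$ to the right. *Action on knots:* $(L_1,\dots,L_k)\cdot((f_1,\alpha_1),\dots,(f_k,\alpha_k))$ is, at time $t$, $\widehat{L_i}\circ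 f_i\circ L_i^{-1}(t)$ with frame $\alpha_i(L_i^{-1}(t))$ if $t\in L_i$, and $(t,0,0)$ with frame $\mathrm{id}$ otherwise. *Action on $AM_n^{fr}$:* $(L_1,\dots,L_k)\cdot(\phi_1,\dots,\phi_k)$ sends $t\in\Delta^n$ to the configuration whose $a$-th point is $\widehat{L_i}$ of the $a$-th position of $\phi_i(\kappa_{L_i}(t))$, with the frame of $\phi_i(\kappa_{L_i}(t))$, if $t_a\in L_i$, and is $(t_a,0,0)$ with frame $\mathrm{id}$ if $t_a$ lies in no $L_i$; $v_{ab}$ is that of $\phi_i(\kappa_{L_i}(t))$ if $t_a,t_b$ lie in the same $L_i$, is $e_1$ if neither $t_a$ nor $t_b$ lies in any $L_i$, and is the normalized difference of positions otherwise. *)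

theory Defs
  imports "HOL-Analysis.Analysis"
begin

section \<open>The cube, the simplex and the conventions for its vertices\<close>

abbreviation I :: "real set" where
  "I \<equiv> {-1..1}"

abbreviation e1 :: "real^3" where
  "e1 \<equiv> axis 1 1"

definition cube :: "(real^3) set" where
  "cube = {x. \<forall>j. x $ j \<in> I}"

text \<open>
  A point of the simplex is a function that is \<open>undefined\<close> outside \<open>{1..n}\<close>;
  \<open>vtx n t a\<close> is \<open>t\<^sub>a\<close> with the conventions \<open>t\<^sub>0 = -1\<close> and \<open>t\<^sub>n\<^sub>+\<^sub>1 = 1\<close>.
\<close>

definition vtx :: "nat \<Rightarrow> (nat \<Rightarrow> real) \<Rightarrow> nat \<Rightarrow> real" where
  "vtx n t a = (if a = 0 then -1 else if a = Suc n then 1 else t a)"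

definition simplex_n :: "nat \<Rightarrow> (nat \<Rightarrow> real) set" where
  "simplex_n n = {t \<in> extensional {1..n}. \<forall>a\<le>n. vtx n t a \<le> vtx n t (Suc a)}"

definition simplex_top :: "nat \<Rightarrow> (nat \<Rightarrow> real) topology" where
  "simplex_top n = subtopology (product_topology (\<lambda>_. euclideanreal) {1..n}) (simplex_n n)"


section \<open>Compactified configuration spaces\<close>

definition pairs :: "nat \<Rightarrow> (nat \<times> nat) set" where
  "pairs m = {(a, b). a < b \<and> b < m}"

text \<open>
  Points are indexed by \<open>{..<m}\<close>, and \<open>v (a, b)\<close> is the direction from point \<open>a\<close> to
  point \<open>b\<close>, for \<open>a < b\<close>.  Note that \<open>sgn x\<close> is the normalized vector \<open>x / norm x\<close>.
\<close>

definition pos_dir_top :: "nat \<Rightarrow> ((nat \<Rightarrow> real^3) \<times> (nat \<times> nat \<Rightarrow> real^3)) topology" where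
  "pos_dir_top m =
     prod_topology (product_topology (\<lambda>_. top_of_set cube) {..<m})
                   (product_topology (\<lambda>_. top_of_set (sphere 0 1)) (pairs m))"

definition open_conf :: "nat \<Rightarrow> ((nat \<Rightarrow> real^3) \<times> (nat \<times> nat \<Rightarrow> real^3)) set" where
  "open_conf m =
     {(x, v). x \<in> {..<m} \<rightarrow>\<^sub>E cube \<and> inj_on x {..<m} \<and>
              v = (\<lambda>(a, b)\<in>pairs m. sgn (x b - x a))}"

definition conf :: "nat \<Rightarrow> ((nat \<Rightarrow> real^3) \<times> (nat \<times> nat \<Rightarrow> real^3)) set" where
  "conf m = pos_dir_top m closure_of open_conf m"


section \<open>Framed configurations with fixed end points\<close>

type_synonym fr_config = "(nat \<Rightarrow> real^3) \<times> (nat \<times> nat \<Rightarrow> real^3) \<times> (nat \<Rightarrow> real^3^3)"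

abbreviation pos :: "fr_config \<Rightarrow> nat \<Rightarrow> real^3" where
  "pos c \<equiv> fst c"

abbreviation dir :: "fr_config \<Rightarrow> nat \<times> nat \<Rightarrow> real^3" where
  "dir c \<equiv> fst (snd c)"

abbreviation frm :: "fr_config \<Rightarrow> nat \<Rightarrow> real^3^3" where
  "frm c \<equiv> snd (snd c)"

definition O3 :: "(real^3^3) set" where
  "O3 = {A. orthogonal_matrix A}"

definition conf_fr :: "nat \<Rightarrow> fr_config set" where
  "conf_fr n =
     {(x, v, \<alpha>). (x, v) \<in> conf (n + 2) \<and> \<alpha> \<in> {..<n + 2} \<rightarrow>\<^sub>E O3 \<and>
        x 0 = - e1 \<and> x (n + 1) = e1 \<and> \<alpha> 0 = mat 1 \<and> \<alpha> (n + 1) = mat 1}"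

definition conf_fr_top :: "nat \<Rightarrow> fr_config topology" where
  "conf_fr_top n =
     subtopology
       (prod_topology (product_topology (\<lambda>_. top_of_set cube) {..<n + 2})
         (prod_topology (product_topology (\<lambda>_. top_of_set (sphere 0 1)) (pairs (n + 2)))
                        (product_topology (\<lambda>_. top_of_set O3) {..<n + 2})))
       (conf_fr n)"

text \<open>
  \<open>doubling n i\<close> is \<open>d\<^sup>i\<close> with target \<open>conf_fr n\<close>, applied to elements of \<open>conf_fr (n - 1)\<close>;
  \<open>merge i\<close> sends the index of a point of the new configuration to the index of the point
  it comes from, so that both \<open>i\<close> and \<open>i + 1\<close> go to \<open>i\<close>.
\<close>

definition merge :: "nat \<Rightarrow> nat \<Rightarrow> nat" where
  "merge i a = (if a \<le> i then a else a - 1)"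

definition doubling :: "nat \<Rightarrow> nat \<Rightarrow> fr_config \<Rightarrow> fr_config" where
  "doubling n i c =
     (\<lambda>a\<in>{..<n + 2}. pos c (merge i a),
      \<lambda>(a, b)\<in>pairs (n + 2).
         if a = i \<and> b = i + 1 then frm c i *v e1 else dir c (merge i a, merge i b),
      \<lambda>a\<in>{..<n + 2}. frm c (merge i a))"

text \<open>
  For \<open>n = 0\<close> the coface condition is vacuous, since \<open>t\<^sub>0 = -1\<close> and \<open>t\<^sub>1 = 1\<close>; so the
  truncated subtraction \<open>n - 1\<close> is harmless.
\<close>

definition AM_fr :: "nat \<Rightarrow> ((nat \<Rightarrow> real) \<Rightarrow> fr_config) set" where
  "AM_fr n =
     {\<phi> \<in> extensional (simplex_n n).
        continuous_map (simplex_top n) (conf_fr_top n) \<phi> \<and>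
        (\<forall>t\<in>simplex_n n. \<forall>i\<le>n.
           vtx n t i = vtx n t (Suc i) \<longrightarrow> \<phi> t \<in> doubling n i ` conf_fr (n - 1))}"


section \<open>Framed long knots and the evaluation map\<close>

definition smooth :: "(real \<Rightarrow> 'a::real_normed_vector) \<Rightarrow> bool" where
  "smooth f \<longleftrightarrow>
     (\<forall>k t. (((\<lambda>g s. vector_derivative g (at s)) ^^ k) f) differentiable (at t))"

definition smooth_embedding :: "(real \<Rightarrow> real^3) \<Rightarrow> bool" where
  "smooth_embedding f \<longleftrightarrow>
     smooth f \<and> (\<forall>t. vector_derivative f (at t) \<noteq> 0) \<and> embedding_map euclidean euclidean f"

type_synonym fr_curve = "(real \<Rightarrow> real^3) \<times> (real \<Rightarrow> real^3^3)"

definition Emb_fr :: "fr_curve set" where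
  "Emb_fr =
     {(f, \<alpha>). smooth_embedding f \<and> f ` I \<subseteq> cube \<and> (\<forall>t. t \<notin> I \<longrightarrow> f t = t *\<^sub>R e1) \<and>
        smooth \<alpha> \<and> (\<forall>t. \<alpha> t \<in> O3) \<and>
        (\<forall>t. column 1 (\<alpha> t) = sgn (vector_derivative f (at t))) \<and>
        (\<forall>t. t \<notin> I \<longrightarrow> \<alpha> t = mat 1)}"

definition ev :: "nat \<Rightarrow> fr_curve \<Rightarrow> (nat \<Rightarrow> real) \<Rightarrow> fr_config" where
  "ev n = (\<lambda>(f, \<alpha>). \<lambda>t\<in>simplex_n n.
     (\<lambda>a\<in>{..<n + 2}. f (vtx n t a),
      \<lambda>(a, b)\<in>pairs (n + 2).
         if vtx n t a \<noteq> vtx n t b then sgn (f (vtx n t b) - f (vtx n t a))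
         else sgn (vector_derivative f (at (vtx n t a))),
      \<lambda>a\<in>{..<n + 2}. \<alpha> (vtx n t a)))"


section \<open>Little intervals and their actions\<close>

text \<open>
  An interval is given by its pair of endpoints.  Elements of \<open>C1 k\<close> are tuples indexed by
  \<open>{1..k}\<close>, for any \<open>k \<ge> 0\<close>; the intervals are nondegenerate and disjoint as closed intervals.
\<close>

type_synonym interval = "real \<times> real"

definition ivl :: "interval \<Rightarrow> real set" where
  "ivl L = {fst L..snd L}"

definition C1 :: "nat \<Rightarrow> (nat \<Rightarrow> interval) set" where
  "C1 k = {L \<in> {1..k} \<rightarrow>\<^sub>E {(l, r). l < r \<and> {l..r} \<subseteq> I}.
             disjoint_family_on (\<lambda>i. ivl (L i)) {1..k}}"

text \<open>The increasing affine bijection of the line that takes \<open>I\<close> onto the interval.\<close>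

definition aff :: "interval \<Rightarrow> real \<Rightarrow> real" where
  "aff L s = (fst L + snd L) / 2 + (snd L - fst L) / 2 * s"

definition hat :: "interval \<Rightarrow> real^3 \<Rightarrow> real^3" where
  "hat L x = (\<chi> j. if j = 1 then aff L (x $ 1) else (snd L - fst L) / 2 * x $ j)"

definition kappa :: "interval \<Rightarrow> real \<Rightarrow> real" where
  "kappa L t = (if t < fst L then -1 else if snd L < t then 1 else inv (aff L) t)"

text \<open>The index of the interval in which a time lies, if there is one.\<close>

definition slot :: "nat \<Rightarrow> (nat \<Rightarrow> interval) \<Rightarrow> real \<Rightarrow> nat option" where
  "slot k L t =
     (if \<exists>i\<in>{1..k}. t \<in> ivl (L i) then Some (THE i. i \<in> {1..k} \<and> t \<in> ivl (L i)) else None)"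

definition knot_action :: "nat \<Rightarrow> (nat \<Rightarrow> interval) \<Rightarrow> (nat \<Rightarrow> fr_curve) \<Rightarrow> fr_curve" where
  "knot_action k L K =
     (\<lambda>t. case slot k L t of
            Some i \<Rightarrow> hat (L i) (fst (K i) (inv (aff (L i)) t))
          | None \<Rightarrow> t *\<^sub>R e1,
      \<lambda>t. case slot k L t of
            Some i \<Rightarrow> snd (K i) (inv (aff (L i)) t)
          | None \<Rightarrow> mat 1)"

definition kappa_simplex :: "nat \<Rightarrow> interval \<Rightarrow> (nat \<Rightarrow> real) \<Rightarrow> nat \<Rightarrow> real" where
  "kappa_simplex n L t = (\<lambda>a\<in>{1..n}. kappa L (t a))"

definition act_pos ::
  "nat \<Rightarrow> nat \<Rightarrow> (nat \<Rightarrow> interval) \<Rightarrow> (nat \<Rightarrow> (nat \<Rightarrow> real) \<Rightarrow> fr_config) \<Rightarrow>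
   (nat \<Rightarrow> real) \<Rightarrow> nat \<Rightarrow> real^3" where
  "act_pos n k L \<Phi> t a =
     (case slot k L (vtx n t a) of
        Some i \<Rightarrow> hat (L i) (pos (\<Phi> i (kappa_simplex n (L i) t)) a)
      | None \<Rightarrow> vtx n t a *\<^sub>R e1)"

text \<open>
  The formula makes sense for arbitrary families of maps from the simplex to configurations.
  Being given pointwise, it does not by itself guarantee a continuous result: for \<open>n \<ge> 2\<close> and
  \<open>\<Phi> i \<in> AM_fr n\<close> with several points located at an end point \<open>\<plusminus>e1\<close>, directions may jump as a
  time enters the interval \<open>L i\<close>.
\<close>

definition AM_action ::
  "nat \<Rightarrow> nat \<Rightarrow> (nat \<Rightarrow> interval) \<Rightarrow> (nat \<Rightarrow> (nat \<Rightarrow> real) \<Rightarrow> fr_config) \<Rightarrow>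
   (nat \<Rightarrow> real) \<Rightarrow> fr_config" where
  "AM_action n k L \<Phi> = (\<lambda>t\<in>simplex_n n.
     (\<lambda>a\<in>{..<n + 2}. act_pos n k L \<Phi> t a,
      \<lambda>(a, b)\<in>pairs (n + 2).
         (case (slot k L (vtx n t a), slot k L (vtx n t b)) of
            (None, None) \<Rightarrow> e1
          | (Some i, Some j) \<Rightarrow>
              if i = j then dir (\<Phi> i (kappa_simplex n (L i) t)) (a, b)
              else sgn (act_pos n k L \<Phi> t b - act_pos n k L \<Phi> t a)
          | _ \<Rightarrow> sgn (act_pos n k L \<Phi> t b - act_pos n k L \<Phi> t a)),
      \<lambda>a\<in>{..<n + 2}.
         (case slot k L (vtx n t a) of
            Some i \<Rightarrow> frm (\<Phi> i (kappa_simplex n (L i) t)) a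
          | None \<Rightarrow> mat 1)))"

end

theory Submission
  imports Defs
begin

text \<open>
  The theorem has three parts.

  \<^emph>\<open>Evaluation lands in the mapping space model.\<close>  The difference \<open>f t - f s\<close> is \<open>t - s\<close> times
  the average of \<open>f'\<close> between \<open>s\<close> and \<open>t\<close>.  This average depends continuously on \<open>(s, t)\<close>,
  equals \<open>f' s\<close> on the diagonal, and vanishes nowhere for an injective immersion.  So
  for \<open>s \<le> t\<close> its normalization is the continuous extension of the secant direction by the unit
  tangent vector (\<open>continuous_map_direction\<close>), and evaluation is continuous on the simplex.
  Distinct times give honest configurations, and every point of the simplex is a limit of
  strictly increasing times, so the values lie in the compactification
  (\<open>ev_in_conf\<close>).  When two consecutive times agree, the configuration is a doubled one because
  the frame has the unit tangent vector as its first column (\<open>ev_doubling\<close>).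

  \<^emph>\<open>Framed knots are stable under the action.\<close>  A rescaled long knot coincides with the axis
  beyond its interval, so the composite agrees near every time with a single smooth curve
  (\<open>glue_locally\<close>).  It is injective, as the first coordinate of a point determines the
  interval it belongs to (\<open>slot_first_coordinate\<close>), and injective long curves are embeddings
  (\<open>long_curve_embedding\<close>).

  \<^emph>\<open>Equivariance.\<close>  Space and time are rescaled by the same factor and without rotation.
  Hence rescaling changes neither secant directions nor velocities, and the configurations on
  both sides agree point by point (\<open>ev_knot_action\<close>).
\<close>


section \<open>Smooth curves\<close>

text \<open>
  Smoothness is the largest property of curves that implies differentiability and is
  inherited by the derivative.  Exhibiting such a property replaces every explicit formula
  for iterated derivatives below.
\<close>

lemma smooth_coinduct:
  fixes f :: "real \<Rightarrow> 'a::real_normed_vector"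
  assumes "P f"
    and diff: "\<And>g t. P g \<Longrightarrow> g differentiable (at t)"
    and step: "\<And>g. P g \<Longrightarrow> P (\<lambda>s. vector_derivative g (at s))"
  shows "smooth f"
proof -
  have "P (((\<lambda>g s. vector_derivative g (at s)) ^^ k) f)" for k
    by (induction k) (auto simp: assms)
  then show ?thesis
    unfolding smooth_def using diff by blast
qed

lemma smooth_differentiable:
  "smooth f \<Longrightarrow> f differentiable (at t)"
  unfolding smooth_def by (metis funpow_0)

lemma smooth_vector_derivative:
  assumes "smooth f" shows "smooth (\<lambda>s. vector_derivative f (at s))"
  unfolding smooth_def
proof (intro allI)
  fix k t
  show "((\<lambda>g s. vector_derivative g (at s)) ^^ k) (\<lambda>s. vector_derivative f (at s)) differentiable at t"
    using assms[unfolded smooth_def, rule_format, of "Suc k" t]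
    by (simp add: funpow_Suc_right del: funpow.simps)
qed

lemma smooth_has_vector_derivative:
  "smooth f \<Longrightarrow> (f has_vector_derivative vector_derivative f (at t)) (at t)"
  using smooth_differentiable vector_derivative_works by blast

lemma smooth_continuous_on: "smooth f \<Longrightarrow> continuous_on S f"
  by (simp add: continuous_at_imp_continuous_on differentiable_imp_continuous_within
      smooth_differentiable)

lemma has_vector_derivative_affine_comp:
  assumes "(f has_vector_derivative f') (at (a * t + b))"
  shows "((\<lambda>t. p + q *\<^sub>R f (a * t + b)) has_vector_derivative (q * a) *\<^sub>R f') (at t)"
proof -
  have "((\<lambda>t. a * t + b) has_vector_derivative a) (at t)"
    by (auto intro!: derivative_eq_intros)
  then have "((f \<circ> (\<lambda>t. a * t + b)) has_vector_derivative a *\<^sub>R f') (at t)"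
    using assms by (rule vector_diff_chain_at)
  then show ?thesis
    by (auto intro!: derivative_eq_intros simp: o_def)
qed

text \<open>
  The curves of this shape, for fixed \<open>a\<close> and \<open>b\<close>, are stable under differentiation: the
  derivative multiplies \<open>q\<close> by \<open>a\<close> and replaces \<open>f\<close> by its derivative.
\<close>

lemma smooth_affine_comp:
  assumes "smooth f" shows "smooth (\<lambda>t. p + q *\<^sub>R f (a * t + b))"
proof (rule smooth_coinduct[where P = "\<lambda>g. \<exists>p q f. smooth f \<and> g = (\<lambda>t. p + q *\<^sub>R f (a * t + b))"])
  show "\<exists>p' q' f'. smooth f' \<and> (\<lambda>t. p + q *\<^sub>R f (a * t + b)) = (\<lambda>t. p' + q' *\<^sub>R f' (a * t + b))"
    using assms by blast
next
  fix g :: "real \<Rightarrow> 'a" and t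
  assume "\<exists>p q f. smooth f \<and> g = (\<lambda>t. p + q *\<^sub>R f (a * t + b))"
  then show "g differentiable at t"
    using has_vector_derivative_affine_comp[OF smooth_has_vector_derivative]
    by (metis differentiableI_vector)
next
  fix g :: "real \<Rightarrow> 'a"
  assume "\<exists>p q f. smooth f \<and> g = (\<lambda>t. p + q *\<^sub>R f (a * t + b))"
  then obtain p q f where f: "smooth f" and g: "g = (\<lambda>t. p + q *\<^sub>R f (a * t + b))"
    by blast
  have "vector_derivative g (at s) = 0 + (q * a) *\<^sub>R vector_derivative f (at (a * s + b))" for s
    unfolding g using has_vector_derivative_affine_comp[OF smooth_has_vector_derivative[OF f]]
    by (simp add: vector_derivative_at)
  then show "\<exists>p q f. smooth f \<and> (\<lambda>s. vector_derivative g (at s)) = (\<lambda>t. p + q *\<^sub>R f (a * t + b))"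
    using smooth_vector_derivative[OF f] by blast
qed

lemma smooth_const: "smooth (\<lambda>t. c)"
  by (rule smooth_coinduct[where P = "\<lambda>g. \<exists>c. g = (\<lambda>t. c)"]) auto

lemma smooth_line: "smooth (\<lambda>t. t *\<^sub>R v)"
proof -
  have der: "((\<lambda>t. t *\<^sub>R v) has_vector_derivative v) (at t)" for t
    by (auto intro!: derivative_eq_intros)
  show ?thesis
    by (rule smooth_coinduct[where P = "\<lambda>g. g = (\<lambda>t. t *\<^sub>R v) \<or> smooth g"])
      (use der in \<open>auto simp: vector_derivative_at smooth_const
        intro: differentiableI_vector smooth_differentiable smooth_vector_derivative\<close>)
qed

lemma vector_derivative_eq_open:
  assumes "open U" "t \<in> U" "\<And>s. s \<in> U \<Longrightarrow> g s = h s"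
  shows "vector_derivative g (at t) = vector_derivative h (at t)"
  by (rule vector_derivative_cong_eq)
    (use assms in \<open>auto simp: eventually_nhds\<close>)

text \<open>
  On an open set where a curve agrees with a smooth one, so do the derivatives; hence the
  property of agreeing locally with smooth curves passes to the derivative.
\<close>

lemma smooth_if_locally_smooth:
  assumes "\<And>t. \<exists>h U. smooth h \<and> open U \<and> t \<in> U \<and> (\<forall>s\<in>U. g s = h s)"
  shows "smooth g"
proof (rule smooth_coinduct[where P = "\<lambda>g. \<forall>t. \<exists>h U. smooth h \<and> open U \<and> t \<in> U \<and> (\<forall>s\<in>U. g s = h s)"])
  show "\<forall>t. \<exists>h U. smooth h \<and> open U \<and> t \<in> U \<and> (\<forall>s\<in>U. g s = h s)"
    using assms by blast
next
  fix g :: "real \<Rightarrow> 'a" and t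
  assume "\<forall>t. \<exists>h U. smooth h \<and> open U \<and> t \<in> U \<and> (\<forall>s\<in>U. g s = h s)"
  then obtain h U where h: "smooth h" "open U" "t \<in> U" "\<forall>s\<in>U. g s = h s"
    by blast
  then have "(g has_vector_derivative vector_derivative h (at t)) (at t)"
    by (metis has_vector_derivative_transform_within_open smooth_has_vector_derivative)
  then show "g differentiable at t"
    by (rule differentiableI_vector)
next
  fix g :: "real \<Rightarrow> 'a"
  assume L: "\<forall>t. \<exists>h U. smooth h \<and> open U \<and> t \<in> U \<and> (\<forall>s\<in>U. g s = h s)"
  show "\<forall>t. \<exists>h U. smooth h \<and> open U \<and> t \<in> U \<and> (\<forall>s\<in>U. vector_derivative g (at s) = h s)"
  proof
    fix t
    obtain h U where h: "smooth h" "open U" "t \<in> U" "\<forall>s\<in>U. g s = h s"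
      using L by blast
    then have "\<forall>s\<in>U. vector_derivative g (at s) = vector_derivative h (at s)"
      using vector_derivative_eq_open by blast
    then show "\<exists>h U. smooth h \<and> open U \<and> t \<in> U \<and> (\<forall>s\<in>U. vector_derivative g (at s) = h s)"
      using h smooth_vector_derivative by blast
  qed
qed


section \<open>Long curves\<close>

text \<open>
  The conditions on long curves are imposed outside the closed interval only; continuity
  carries them to the two end points.
\<close>

lemma eq_at_endpoints:
  fixes f g :: "real \<Rightarrow> 'a::t2_space"
  assumes "continuous_on UNIV f" "continuous_on UNIV g" "\<And>t. t \<notin> I \<Longrightarrow> f t = g t"
    and "s \<notin> {-1<..<1}"
  shows "f s = g s"
proof -
  have "closed {t. f t = g t}"
    using assms(1,2) by (simp add: closed_Collect_eq)
  moreover have "- I \<subseteq> {t. f t = g t}"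
    using assms(3) by blast
  ultimately have "closure (- I) \<subseteq> {t. f t = g t}"
    by (rule closure_minimal[rotated])
  moreover have "s \<in> closure (- I)"
    using assms(4) by (simp add: closure_complement)
  ultimately show ?thesis
    by blast
qed

text \<open>
  A long curve is a closed map: the image of a closed set is the union of a compact set, coming
  from the times in \<open>I\<close>, and of a closed subset of a line.  So injectivity suffices for the
  inverse to be continuous on the image.
\<close>

lemma long_curve_embedding:
  fixes f :: "real \<Rightarrow> 'a::euclidean_space"
  assumes cont: "continuous_on UNIV f" and "inj f" and "v \<noteq> 0"
    and straight: "\<And>t. t \<notin> I \<Longrightarrow> f t = t *\<^sub>R v"
  shows "embedding_map euclidean euclidean f"
proof (rule injective_closed_imp_embedding_map)
  show "continuous_map euclidean euclidean f"
    using cont by simp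
  show "inj_on f (topspace euclidean)"
    using \<open>inj f\<close> by simp
  show "closed_map euclidean euclidean f"
    unfolding closed_map_def
  proof (intro allI impI)
    fix C :: "real set" assume "closedin euclidean C"
    then have C: "closed C" by simp
    have "compact (f ` (C \<inter> I))"
      using cont C by (intro compact_continuous_image)
        (auto intro: continuous_on_subset closed_Int_compact)
    moreover have "closed ((\<lambda>t. t *\<^sub>R v) ` (C - {-1<..<1}))"
    proof (rule closed_injective_linear_image)
      show "closed (C - {-1<..<1})"
        using C by (intro closed_Diff) auto
      show "linear (\<lambda>t. t *\<^sub>R v)" 
        by (rule linear_scaleR_left)
      show "inj (\<lambda>t. t *\<^sub>R v)"
        using \<open>v \<noteq> 0\<close> by (auto simp: inj_def)
    qed
    moreover have "f ` C = f ` (C \<inter> I) \<union> (\<lambda>t. t *\<^sub>R v) ` (C - {-1<..<1})"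
    proof -
      have out: "f s = s *\<^sub>R v" if "s \<in> C - {-1<..<1}" for s
      proof (rule eq_at_endpoints[OF cont _ straight])
        show "continuous_on UNIV (\<lambda>t. t *\<^sub>R v)"
          by (intro continuous_intros)
      qed (use that in auto)
      have "C = (C \<inter> I) \<union> (C - {-1<..<1})"
        by (auto simp: not_less)
      then have "f ` C = f ` (C \<inter> I) \<union> f ` (C - {-1<..<1})"
        by (metis image_Un)
      also have "f ` (C - {-1<..<1}) = (\<lambda>t. t *\<^sub>R v) ` (C - {-1<..<1})"
        using out by (rule image_cong[OF refl])
      finally show ?thesis .
    qed
    ultimately show "closedin euclidean (f ` C)"
      by (simp add: compact_imp_closed closed_Un)
  qed
qed


section \<open>Directions of chords\<close>

text \<open>
  The average velocity between two times.  The integral makes sense when the times coincide,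
  which turns the continuity of difference quotients across the diagonal into the continuity
  of an integral in its parameters.
\<close>

definition chord :: "(real \<Rightarrow> 'a::euclidean_space) \<Rightarrow> real \<Rightarrow> real \<Rightarrow> 'a" where
  "chord f s t = integral {0..1} (\<lambda>u. vector_derivative f (at (s + u * (t - s))))"

lemma chord_scaleR:
  assumes "smooth f" shows "(t - s) *\<^sub>R chord f s t = f t - f s"
proof -
  \<comment> \<open>The integrand is the derivative of \<open>u \<mapsto> f (s + u (t - s))\<close>.\<close>
  have "((\<lambda>u. (t - s) *\<^sub>R vector_derivative f (at (s + u * (t - s)))) has_integral
          (f (s + 1 * (t - s)) - f (s + 0 * (t - s)))) {0..1}"
  proof (rule fundamental_theorem_of_calculus)
    fix u :: real
    have "((\<lambda>u. 0 + 1 *\<^sub>R f ((t - s) * u + s)) has_vector_derivative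
            (1 * (t - s)) *\<^sub>R vector_derivative f (at ((t - s) * u + s))) (at u)"
      by (intro has_vector_derivative_affine_comp smooth_has_vector_derivative assms)
    then show "((\<lambda>u. f (s + u * (t - s))) has_vector_derivative
            (t - s) *\<^sub>R vector_derivative f (at (s + u * (t - s)))) (at u within {0..1})"
      by (simp add: algebra_simps has_vector_derivative_at_within)
  qed simp
  from integral_unique[OF this] show ?thesis
    by (simp add: chord_def)
qed

lemma chord_same: "chord f s s = vector_derivative f (at s)"
  by (simp add: chord_def)

lemma continuous_chord:
  assumes "smooth f" shows "continuous_on UNIV (\<lambda>(s, t). chord f s t)"
proof -
  have "continuous_on UNIV (\<lambda>s. vector_derivative f (at s))"
    using assms smooth_continuous_on smooth_vector_derivative by blast
  then have "continuous_on (UNIV \<times> cbox 0 1)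
      (\<lambda>(x, u). vector_derivative f (at (fst x + u * (snd x - fst x))))"
    unfolding split_beta
    by (rule continuous_on_compose2) (auto intro!: continuous_intros)
  from integral_continuous_on_param[OF this] show ?thesis
    by (simp add: chord_def split_beta)
qed

definition direction :: "(real \<Rightarrow> 'a::euclidean_space) \<Rightarrow> real \<Rightarrow> real \<Rightarrow> 'a" where
  "direction f s t = (if s \<noteq> t then sgn (f t - f s) else sgn (vector_derivative f (at s)))"

text \<open>
  For \<open>s < t\<close> the chord differs from \<open>f t - f s\<close> by a positive factor.  The order of the times
  matters: near the diagonal, but with \<open>t < s\<close>, the direction is close to the opposite of the
  unit tangent vector.
\<close>

lemma direction_eq_sgn_chord:
  assumes "smooth f" "s \<le> t" shows "direction f s t = sgn (chord f s t)"
proof (cases "s = t")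
  case False
  then have "sgn (f t - f s) = sgn (t - s) *\<^sub>R sgn (chord f s t)"
    by (metis assms(1) chord_scaleR sgn_scaleR)
  then show ?thesis
    using False assms(2) by (simp add: direction_def)
qed (simp add: direction_def chord_same)

lemma chord_nonzero:
  assumes "smooth f" "inj f" "vector_derivative f (at s) \<noteq> 0" shows "chord f s t \<noteq> 0"
proof (cases "s = t")
  case False
  then have "(t - s) *\<^sub>R chord f s t \<noteq> 0"
    using assms by (auto simp: chord_scaleR dest: injD)
  then show ?thesis by auto
qed (use assms in \<open>simp add: chord_same\<close>)


section \<open>Times of points of the simplex\<close>

lemma vtx_mono:
  assumes "t \<in> simplex_n n" "a \<le> b" "b \<le> Suc n"
  shows "vtx n t a \<le> vtx n t b"
  using assms(2,3)
proof (induction b rule: dec_induct)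
  case (step b)
  then show ?case
    using assms(1) by (force simp: simplex_n_def)
qed simp

lemma vtx_0 [simp]: "vtx n t 0 = -1"
  and vtx_last [simp]: "vtx n t (Suc n) = 1"
  by (simp_all add: vtx_def)

lemma vtx_in_I:
  assumes "t \<in> simplex_n n" "a \<le> Suc n"
  shows "vtx n t a \<in> I"
  using vtx_mono[OF assms(1), of 0 a] vtx_mono[OF assms(1), of a "Suc n"] assms(2) by simp

text \<open>
  Points of the simplex are built from all \<open>n + 2\<close> times at once, so that the conventional
  times at both ends need no separate treatment.
\<close>

lemma simplex_point_of_times:
  assumes "\<tau> 0 = -1" "\<tau> (Suc n) = 1" "\<And>a. a \<le> n \<Longrightarrow> \<tau> a \<le> \<tau> (Suc a)"
  shows "restrict \<tau> {1..n} \<in> simplex_n n"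
    and "\<And>a. a \<le> Suc n \<Longrightarrow> vtx n (restrict \<tau> {1..n}) a = \<tau> a"
proof -
  show *: "vtx n (restrict \<tau> {1..n}) a = \<tau> a" if "a \<le> Suc n" for a
    using that assms(1,2) by (auto simp: vtx_def)
  show "restrict \<tau> {1..n} \<in> simplex_n n"
    using assms(3) * by (simp add: simplex_n_def del: atLeastAtMost_iff One_nat_def)
qed

lemma topspace_simplex_top [simp]: "topspace (simplex_top n) = simplex_n n"
  by (auto simp: simplex_top_def simplex_n_def PiE_UNIV_domain extensional_def)

lemma continuous_map_vtx:
  "continuous_map (simplex_top n) euclideanreal (\<lambda>t. vtx n t a)" if "a \<le> Suc n"
proof (cases "a = 0 \<or> a = Suc n")
  case True
  then show ?thesis by (auto simp: vtx_def)
next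
  case False
  with that have "a \<in> {1..n}" by auto
  then have "continuous_map (simplex_top n) euclideanreal (\<lambda>t. t a)"
    unfolding simplex_top_def
    by (intro continuous_map_from_subtopology continuous_map_product_projection)
  then show ?thesis using False by (simp add: vtx_def)
qed

lemma continuous_map_curve:
  fixes f :: "real \<Rightarrow> 'a::topological_space"
  assumes "continuous_on UNIV f" "f ` I \<subseteq> S" "a \<le> Suc n"
  shows "continuous_map (simplex_top n) (top_of_set S) (\<lambda>t. f (vtx n t a))"
proof -
  have "continuous_map (simplex_top n) euclidean (f \<circ> (\<lambda>t. vtx n t a))"
    using assms(1) by (intro continuous_map_compose[OF continuous_map_vtx[OF assms(3)]]) simp
  then show ?thesis
    using assms(2,3) vtx_in_I by (fastforce simp: continuous_map_in_subtopology o_def)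
qed

lemma continuous_map_tuple:
  assumes "\<And>a. a \<in> J \<Longrightarrow> continuous_map X Y (\<lambda>t. F t a)"
  shows "continuous_map X (product_topology (\<lambda>_. Y) J) (\<lambda>t. restrict (F t) J)"
  using assms by (auto simp: continuous_map_componentwise)

text \<open>
  Times of a simplex point are ordered, so the direction is the normalized average velocity;
  that vector vanishes nowhere, off the diagonal because \<open>f\<close> is injective and on it because
  \<open>f\<close> is an immersion.
\<close>

lemma continuous_map_direction:
  fixes f :: "real \<Rightarrow> 'a::euclidean_space"
  assumes f: "smooth f" "inj f" "\<And>s. vector_derivative f (at s) \<noteq> 0"
    and ab: "a \<le> b" "b \<le> Suc n"
  shows "continuous_map (simplex_top n) (top_of_set (sphere 0 1))
           (\<lambda>t. direction f (vtx n t a) (vtx n t b))"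
proof -
  let ?g = "\<lambda>(s, t). sgn (chord f s t)"
  have "continuous_on UNIV ?g"
    unfolding split_beta
    by (intro continuous_on_sgn continuous_chord[OF f(1), unfolded split_beta])
      (use chord_nonzero[OF f] in auto)
  then have "continuous_map (prod_topology euclidean euclidean) euclidean ?g"
    by (simp add: prod_topology_euclidean)
  with continuous_map_compose continuous_map_pairedI[OF continuous_map_vtx continuous_map_vtx]
  have "continuous_map (simplex_top n) euclidean (?g \<circ> (\<lambda>t. (vtx n t a, vtx n t b)))"
    using ab by (meson le_trans)
  then have "continuous_map (simplex_top n) (top_of_set (sphere 0 1))
           (\<lambda>t. sgn (chord f (vtx n t a) (vtx n t b)))"
    using chord_nonzero[OF f] by (simp add: continuous_map_in_subtopology o_def norm_sgn)
  then show ?thesis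
    by (rule continuous_map_eq) (simp add: direction_eq_sgn_chord f(1) vtx_mono ab)
qed


section \<open>Evaluation of a framed knot\<close>

lemma ev_simps:
  assumes "t \<in> simplex_n n"
  shows "ev n (f, \<alpha>) t =
    (\<lambda>a\<in>{..<n + 2}. f (vtx n t a),
     \<lambda>(a, b)\<in>pairs (n + 2). direction f (vtx n t a) (vtx n t b),
     \<lambda>a\<in>{..<n + 2}. \<alpha> (vtx n t a))"
  using assms by (simp add: ev_def direction_def)

lemma Emb_frD:
  assumes "(f, \<alpha>) \<in> Emb_fr"
  shows "smooth f" "\<And>t. vector_derivative f (at t) \<noteq> 0" "inj f" "f ` I \<subseteq> cube"
    "smooth \<alpha>" "\<And>t. \<alpha> t \<in> O3" "\<And>t. column 1 (\<alpha> t) = sgn (vector_derivative f (at t))"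
    "\<And>t. t \<notin> I \<Longrightarrow> f t = t *\<^sub>R e1" "\<And>t. t \<notin> I \<Longrightarrow> \<alpha> t = mat 1"
proof -
  show "inj f"
    using assms by (auto simp: Emb_fr_def smooth_embedding_def embedding_map_def
        dest!: homeomorphic_imp_injective_map)
qed (use assms in \<open>auto simp: Emb_fr_def smooth_embedding_def\<close>)

lemma Emb_fr_ends:
  assumes "(f, \<alpha>) \<in> Emb_fr" "s \<notin> {-1<..<1}"
  shows "f s = s *\<^sub>R e1" "\<alpha> s = mat 1"
proof -
  note c = Emb_frD[OF assms(1)]
  show "f s = s *\<^sub>R e1"
    by (rule eq_at_endpoints[OF _ _ c(8) assms(2)])
      (intro smooth_continuous_on c(1) smooth_line)+
  show "\<alpha> s = mat 1"
    by (rule eq_at_endpoints[OF _ _ c(9) assms(2)])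
      (intro smooth_continuous_on c(5) smooth_const)+
qed

lemma ev_pos_dir_continuous:
  assumes "(f, \<alpha>) \<in> Emb_fr"
  shows "continuous_map (simplex_top n) (pos_dir_top (n + 2))
    (\<lambda>t. (\<lambda>a\<in>{..<n + 2}. f (vtx n t a),
          \<lambda>(a, b)\<in>pairs (n + 2). direction f (vtx n t a) (vtx n t b)))"
proof -
  note c = Emb_frD[OF assms]
  show ?thesis
    unfolding pos_dir_top_def
  proof (intro continuous_map_pairedI continuous_map_tuple)
    show "continuous_map (simplex_top n) (top_of_set cube) (\<lambda>t. f (vtx n t a))"
      if "a \<in> {..<n + 2}" for a
      using that by (intro continuous_map_curve smooth_continuous_on c) auto
    show "continuous_map (simplex_top n) (top_of_set (sphere 0 1))
        (\<lambda>t. case p of (a, b) \<Rightarrow> direction f (vtx n t a) (vtx n t b))"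
      if "p \<in> pairs (n + 2)" for p
      using that continuous_map_direction[OF c(1,3,2), of "fst p" "snd p" n]
      by (auto simp: pairs_def)
  qed
qed

text \<open>
  Pushing the times \<open>t\<close> slightly towards equidistant ones makes them pairwise distinct.  By
  injectivity of \<open>f\<close> the configuration then lies in the open configuration space, and by
  continuity it converges to the given one as the push tends to zero.
\<close>

lemma ev_in_conf:
  assumes K: "(f, \<alpha>) \<in> Emb_fr" and t: "t \<in> simplex_n n"
  shows "(\<lambda>a\<in>{..<n + 2}. f (vtx n t a),
          \<lambda>(a, b)\<in>pairs (n + 2). direction f (vtx n t a) (vtx n t b)) \<in> conf (n + 2)"
    (is "?\<Psi> t \<in> _")
proof -
  note c = Emb_frD[OF K]
  \<comment> \<open>Equidistant times; being strictly increasing, they make every proper mixture with \<open>t\<close>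
    strictly increasing.\<close>
  define u where "u a = -1 + 2 * real a / real (Suc n)" for a
  have u: "u a < u b" if "a < b" for a b
    using that by (simp add: u_def divide_strict_right_mono)
  have u_ends: "u 0 = -1" "u (Suc n) = 1"
    by (simp_all add: u_def field_simps)
  define \<tau> where "\<tau> e a = (1 - e) * vtx n t a + e * u a" for e a
  define p where "p e = restrict (\<tau> e) {1..n}" for e
  have less: "\<tau> e a < \<tau> e b" if "e \<in> {0<..1}" "a < b" "b \<le> Suc n" for e a b
    unfolding \<tau>_def using that vtx_mono[OF t, of a b] u[of a b]
    by (intro add_le_less_mono mult_left_mono mult_strict_left_mono) auto
  have le: "\<tau> e a \<le> \<tau> e (Suc a)" if "e \<in> {0..1}" "a \<le> n" for e a
    unfolding \<tau>_def using that vtx_mono[OF t, of a "Suc a"] u[of a "Suc a"]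
    by (intro add_mono mult_left_mono) auto
  have ends: "\<tau> e 0 = -1" "\<tau> e (Suc n) = 1" for e
    by (simp_all add: \<tau>_def u_ends algebra_simps)
  have p: "p e \<in> simplex_n n" "\<And>a. a \<le> Suc n \<Longrightarrow> vtx n (p e) a = \<tau> e a"
    if "e \<in> {0..1}" for e
    unfolding p_def using simplex_point_of_times[OF ends le[OF that]] by auto
  have "continuous_map (top_of_set {0..1}) (simplex_top n) p"
    unfolding simplex_top_def continuous_map_in_subtopology
  proof
    show "continuous_map (top_of_set {0..1})
        (product_topology (\<lambda>_. euclideanreal) {1..n}) p"
      unfolding p_def \<tau>_def
      by (intro continuous_map_tuple) (auto intro!: continuous_intros)
    show "p \<in> topspace (top_of_set {0..1}) \<rightarrow> simplex_n n"
      using p(1) by auto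
  qed
  from continuous_map_compose[OF this ev_pos_dir_continuous[OF K]]
  have "(?\<Psi> \<circ> p) ` (top_of_set {0..1} closure_of {0<..1}) \<subseteq>
      pos_dir_top (n + 2) closure_of (?\<Psi> \<circ> p) ` {0<..1}"
    by (rule continuous_map_image_closure_subset)
  also have "\<dots> \<subseteq> conf (n + 2)"
    unfolding conf_def
  proof (rule closure_of_mono, rule image_subsetI)
    fix e :: real assume e: "e \<in> {0<..1}"
    then have ps: "p e \<in> simplex_n n" and pv: "\<And>a. a < n + 2 \<Longrightarrow> vtx n (p e) a = \<tau> e a"
      using p[of e] by auto
    have inj: "inj_on (\<tau> e) {..<n + 2}"
      by (rule linorder_inj_onI) (use less[OF e] in \<open>force+\<close>)
    have "(\<lambda>a\<in>{..<n + 2}. f (\<tau> e a)) \<in> {..<n + 2} \<rightarrow>\<^sub>E cube"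
    proof (rule restrict_PiE_iff[THEN iffD2], rule ballI)
      fix a assume "a \<in> {..<n + 2}"
      then have "\<tau> e a \<in> I"
        using vtx_in_I[OF ps, of a] pv[of a] by simp
      then show "f (\<tau> e a) \<in> cube"
        using c(4) by blast
    qed
    moreover have "inj_on (\<lambda>a\<in>{..<n + 2}. f (\<tau> e a)) {..<n + 2}"
      using inj c(3) by (auto simp: inj_on_def)
    moreover have "?\<Psi> (p e) = (\<lambda>a\<in>{..<n + 2}. f (\<tau> e a),
        \<lambda>(a, b)\<in>pairs (n + 2). sgn ((\<lambda>a\<in>{..<n + 2}. f (\<tau> e a)) b - (\<lambda>a\<in>{..<n + 2}. f (\<tau> e a)) a))"
      using inj by (auto simp: pv pairs_def direction_def restrict_def fun_eq_iff inj_on_def)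
    ultimately show "(?\<Psi> \<circ> p) e \<in> open_conf (n + 2)"
      by (simp add: open_conf_def)
  qed
  finally have sub: "(?\<Psi> \<circ> p) ` (top_of_set {0..1} closure_of {0<..1}) \<subseteq> conf (n + 2)" .
  have "0 \<in> top_of_set {0..1} closure_of {0<..1::real}"
    by (simp add: closure_of_subtopology Int_absorb1 subset_iff)
  with sub have "?\<Psi> (p 0) \<in> conf (n + 2)"
    by auto
  moreover have "?\<Psi> (p 0) = ?\<Psi> t"
    using p(2)[of 0] by (auto simp: \<tau>_def pairs_def restrict_def fun_eq_iff)
  ultimately show ?thesis by (simp only:)
qed

lemma ev_in_conf_fr:
  assumes K: "(f, \<alpha>) \<in> Emb_fr" and t: "t \<in> simplex_n n"
  shows "ev n (f, \<alpha>) t \<in> conf_fr n"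
  using ev_in_conf[OF K t] Emb_frD(6)[OF K] Emb_fr_ends[OF K]
  by (auto simp: ev_simps[OF t] conf_fr_def)

lemma ev_continuous:
  assumes K: "(f, \<alpha>) \<in> Emb_fr"
  shows "continuous_map (simplex_top n) (conf_fr_top n) (ev n (f, \<alpha>))"
proof -
  let ?x = "\<lambda>t. \<lambda>a\<in>{..<n + 2}. f (vtx n t a)"
  let ?v = "\<lambda>t. \<lambda>(a, b)\<in>pairs (n + 2). direction f (vtx n t a) (vtx n t b)"
  let ?\<alpha> = "\<lambda>t. \<lambda>a\<in>{..<n + 2}. \<alpha> (vtx n t a)"
  note c = Emb_frD[OF K]
  have "continuous_map (simplex_top n) (product_topology (\<lambda>_. top_of_set O3) {..<n + 2}) ?\<alpha>"
    by (intro continuous_map_tuple continuous_map_curve smooth_continuous_on c)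
      (use c(6) in auto)
  then have "continuous_map (simplex_top n)
       (prod_topology (product_topology (\<lambda>_. top_of_set cube) {..<n + 2})
         (prod_topology (product_topology (\<lambda>_. top_of_set (sphere 0 1)) (pairs (n + 2)))
                        (product_topology (\<lambda>_. top_of_set O3) {..<n + 2})))
       (\<lambda>t. (?x t, ?v t, ?\<alpha> t))"
    using ev_pos_dir_continuous[OF K, of n]
    by (simp add: pos_dir_top_def continuous_map_pairwise o_def)
  then have "continuous_map (simplex_top n)
       (prod_topology (product_topology (\<lambda>_. top_of_set cube) {..<n + 2})
         (prod_topology (product_topology (\<lambda>_. top_of_set (sphere 0 1)) (pairs (n + 2)))
                        (product_topology (\<lambda>_. top_of_set O3) {..<n + 2})))
       (ev n (f, \<alpha>))"
    by (rule continuous_map_eq) (simp add: ev_simps)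
  then show ?thesis
    using ev_in_conf_fr[OF K] by (simp add: conf_fr_top_def continuous_map_in_subtopology)
qed

text \<open>
  Forgetting one of two equal times gives a point of the simplex of one dimension less, whose
  evaluation doubles to the given one.  The frame condition is what makes the new direction
  right: the first column of the frame is the unit tangent vector.
\<close>

lemma ev_doubling:
  assumes K: "(f, \<alpha>) \<in> Emb_fr" and t: "t \<in> simplex_n n"
    and i: "i \<le> n" "vtx n t i = vtx n t (Suc i)"
  shows "ev n (f, \<alpha>) t \<in> doubling n i ` conf_fr (n - 1)"
proof (cases n)
  case 0
  then show ?thesis using i by (simp add: vtx_def)
next
  case n: (Suc m)
  \<comment> \<open>The times with the one of index \<open>i + 1\<close> left out.\<close>
  define \<tau> where "\<tau> a = vtx n t (if a \<le> i then a else Suc a)" for a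
  define t' where "t' = restrict \<tau> {1..m}"
  have "\<tau> 0 = -1" "\<tau> (Suc m) = 1"
    using i by (auto simp: \<tau>_def n le_Suc_eq)
  moreover have "\<tau> a \<le> \<tau> (Suc a)" if "a \<le> m" for a
    unfolding \<tau>_def using that n by (intro vtx_mono[OF t]) auto
  ultimately have t': "t' \<in> simplex_n m" and "\<And>a. a \<le> Suc m \<Longrightarrow> vtx m t' a = \<tau> a"
    unfolding t'_def using simplex_point_of_times by blast+
  moreover have "\<tau> (merge i a) = vtx n t a" for a
    using i(2) by (cases "a = Suc i") (auto simp: \<tau>_def merge_def)
  moreover have merge: "merge i a \<le> Suc m" if "a < n + 2" for a
    using that i(1) n by (auto simp: merge_def)
  ultimately have v: "vtx m t' (merge i a) = vtx n t a" if "a < n + 2" for a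
    using that by simp
  have merge_pairs: "(merge i a, merge i b) \<in> pairs (m + 2)"
    if "(a, b) \<in> pairs (n + 2)" "\<not> (a = i \<and> b = i + 1)" for a b
    using that i(1) n by (auto simp: merge_def pairs_def)
  have "i < m + 2" "merge i i = i"
    using i(1) n by (auto simp: merge_def)
  then have "frm (ev m (f, \<alpha>) t') i *v e1 = \<alpha> (vtx n t i) *v e1"
    using v[of i] n by (simp add: ev_simps[OF t'])
  also have "\<dots> = column 1 (\<alpha> (vtx n t i))"
    by (simp add: matrix_vector_mult_basis)
  also have "\<dots> = direction f (vtx n t i) (vtx n t (i + 1))"
    using i(2) Emb_frD(7)[OF K] by (simp add: direction_def)
  finally have doubled: "frm (ev m (f, \<alpha>) t') i *v e1 = direction f (vtx n t i) (vtx n t (i + 1))" .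
  have "ev n (f, \<alpha>) t = doubling n i (ev m (f, \<alpha>) t')"
    unfolding doubling_def ev_simps[OF t]
  proof (intro prod_eqI; simp only: fst_conv snd_conv; intro restrict_ext)
    fix a assume "a \<in> {..<n + 2}"
    then show "f (vtx n t a) = pos (ev m (f, \<alpha>) t') (merge i a)"
      and "\<alpha> (vtx n t a) = frm (ev m (f, \<alpha>) t') (merge i a)"
      using v[of a] merge[of a] by (auto simp: ev_simps[OF t'])
  next
    fix p assume p: "p \<in> pairs (n + 2)"
    obtain a b where ab: "p = (a, b)" by fastforce
    with p have "a < n + 2" "b < n + 2" by (auto simp: pairs_def)
    then have "dir (ev m (f, \<alpha>) t') (merge i a, merge i b) = direction f (vtx n t a) (vtx n t b)"
      if "\<not> (a = i \<and> b = i + 1)"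
      using that v merge_pairs[of a b] p ab by (simp add: ev_simps[OF t'])
    then show "(case p of (a, b) \<Rightarrow> direction f (vtx n t a) (vtx n t b)) =
      (case p of (a, b) \<Rightarrow> if a = i \<and> b = i + 1 then frm (ev m (f, \<alpha>) t') i *v e1
         else dir (ev m (f, \<alpha>) t') (merge i a, merge i b))"
      using ab doubled by auto
  qed
  then show ?thesis
    using ev_in_conf_fr[OF K t'] n by auto
qed

lemma ev_in_AM_fr: "ev n \<in> Emb_fr \<rightarrow> AM_fr n"
proof
  fix c assume "c \<in> Emb_fr"
  then obtain f \<alpha> where c: "c = (f, \<alpha>)" "(f, \<alpha>) \<in> Emb_fr"
    by (cases c) simp
  have "ev n (f, \<alpha>) \<in> extensional (simplex_n n)"
    by (simp add: ev_def)
  then show "ev n c \<in> AM_fr n"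
    unfolding AM_fr_def c(1) using ev_continuous[OF c(2)] ev_doubling[OF c(2)] by blast
qed


section \<open>Affine reparametrization by an interval\<close>

lemma inj_aff:
  assumes "fst L < snd L" shows "inj (aff L)"
  using assms by (auto simp: inj_def aff_def)

lemma aff_divide:
  assumes "fst L < snd L"
  shows "aff L ((t - (fst L + snd L) / 2) / ((snd L - fst L) / 2)) = t"
proof -
  have "c + h * ((t - c) / h) = t" if "h \<noteq> 0" for c h :: real
    using that by simp
  moreover have "(snd L - fst L) / 2 \<noteq> 0"
    using assms by simp
  ultimately show ?thesis
    unfolding aff_def by blast
qed

lemma inv_aff_affine:
  assumes "fst L < snd L"
  obtains b where "inv (aff L) = (\<lambda>t. 2 / (snd L - fst L) * t + b)"
proof
  have "inv (aff L) t = (t - (fst L + snd L) / 2) / ((snd L - fst L) / 2)" for t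
    by (rule inv_f_eq[OF inj_aff[OF assms] aff_divide[OF assms]])
  moreover have "(t - c) / (w / 2) = 2 / w * t + - c / (w / 2)" for t c w :: real
    by (simp add: diff_divide_distrib)
  ultimately show "inv (aff L) = (\<lambda>t. 2 / (snd L - fst L) * t +
      - ((fst L + snd L) / 2) / ((snd L - fst L) / 2))"
    by (simp only: fun_eq_iff) blast
qed

lemma aff_inv:
  assumes "fst L < snd L" shows "aff L (inv (aff L) t) = t"
  using aff_divide[OF assms] by (rule f_inv_into_f[OF range_eqI, OF sym])

lemma inv_aff_mono_iff:
  assumes "fst L < snd L" shows "inv (aff L) s \<le> inv (aff L) t \<longleftrightarrow> s \<le> t"
proof -
  obtain b where "inv (aff L) = (\<lambda>t. 2 / (snd L - fst L) * t + b)"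
    using inv_aff_affine[OF assms] .
  then show ?thesis
    using assms by (simp add: divide_le_cancel)
qed

lemma inv_aff_endpoints:
  assumes "fst L < snd L" shows "inv (aff L) (fst L) = -1" "inv (aff L) (snd L) = 1"
  using assms by (auto intro!: inv_f_eq inj_aff simp: aff_def field_simps)

lemma inv_aff_in_I_iff:
  assumes "fst L < snd L" shows "inv (aff L) t \<in> I \<longleftrightarrow> t \<in> ivl L"
  using inv_aff_mono_iff[OF assms, of "fst L" t] inv_aff_mono_iff[OF assms, of t "snd L"]
  by (simp add: inv_aff_endpoints[OF assms] ivl_def)

lemma inv_aff_eq_iff:
  assumes "fst L < snd L" shows "inv (aff L) s = inv (aff L) t \<longleftrightarrow> s = t"
  by (metis assms aff_inv)

lemma kappa_in: "t \<in> ivl L \<Longrightarrow> kappa L t = inv (aff L) t"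
  by (auto simp: kappa_def ivl_def)

lemma kappa_mono:
  assumes "fst L < snd L" "s \<le> t" shows "kappa L s \<le> kappa L t"
  using assms inv_aff_mono_iff[OF assms(1), of s t] inv_aff_in_I_iff[OF assms(1), of s]
    inv_aff_in_I_iff[OF assms(1), of t]
  by (auto simp: kappa_def ivl_def)

lemma kappa_endpoints:
  assumes "fst L < snd L" "ivl L \<subseteq> I" shows "kappa L (-1) = -1" "kappa L 1 = 1"
proof -
  have "-1 \<le> fst L" "snd L \<le> 1"
    using assms by (auto simp: ivl_def)
  then show "kappa L (-1) = -1" "kappa L 1 = 1"
    using assms(1) inv_aff_endpoints[OF assms(1)]
    by (auto simp: kappa_def order.order_iff_strict)
qed

text \<open>
  The clamped times keep the values \<open>-1\<close> and \<open>1\<close> at both ends because the interval is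
  contained in \<open>I\<close>.
\<close>

lemma vtx_kappa_simplex:
  assumes "fst L < snd L" "ivl L \<subseteq> I" "t \<in> simplex_n n"
  shows "kappa_simplex n L t \<in> simplex_n n"
    and "\<And>a. a \<le> Suc n \<Longrightarrow> vtx n (kappa_simplex n L t) a = kappa L (vtx n t a)"
proof -
  have eq: "kappa_simplex n L t = restrict (\<lambda>a. kappa L (vtx n t a)) {1..n}"
    by (auto simp: kappa_simplex_def vtx_def)
  have mono: "kappa L (vtx n t a) \<le> kappa L (vtx n t (Suc a))" if "a \<le> n" for a
    using that by (intro kappa_mono[OF assms(1)] vtx_mono[OF assms(3)]) auto
  note * = simplex_point_of_times[of "\<lambda>a. kappa L (vtx n t a)", OF _ _ mono]
  show "kappa_simplex n L t \<in> simplex_n n"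
    unfolding eq by (rule *(1)) (simp_all add: kappa_endpoints assms)
  show "vtx n (kappa_simplex n L t) a = kappa L (vtx n t a)" if "a \<le> Suc n" for a
    unfolding eq by (rule *(2)) (simp_all add: kappa_endpoints assms that)
qed

lemma hat_eq: "hat L x = ((fst L + snd L) / 2) *\<^sub>R e1 + ((snd L - fst L) / 2) *\<^sub>R x"
  by (simp add: hat_def vec_eq_iff aff_def axis_def)

lemma hat_fst: "hat L x $ 1 = aff L (x $ 1)"
  by (simp add: hat_def)

lemma hat_line: "hat L (s *\<^sub>R e1) = aff L s *\<^sub>R e1"
  by (simp add: hat_eq aff_def algebra_simps)

lemma hat_eq_iff:
  assumes "fst L < snd L" shows "hat L x = hat L y \<longleftrightarrow> x = y"
  using assms by (simp add: hat_eq)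

text \<open>
  The rescaling of space is a positive homothety followed by a translation, so it preserves
  directions.
\<close>

lemma sgn_hat_diff:
  assumes "fst L < snd L" shows "sgn (hat L x - hat L y) = sgn (x - y)"
proof -
  have "hat L x - hat L y = ((snd L - fst L) / 2) *\<^sub>R (x - y)"
    by (simp add: hat_eq algebra_simps)
  then show ?thesis
    using assms by (simp add: sgn_scaleR)
qed

lemma aff_in_ivl:
  assumes "fst L < snd L" "s \<in> I" shows "aff L s \<in> ivl L"
proof -
  have "inv (aff L) (aff L s) = s"
    by (rule inv_f_f[OF inj_aff[OF assms(1)]])
  then show ?thesis
    using inv_aff_in_I_iff[OF assms(1), of "aff L s"] assms(2) by simp
qed

lemma hat_cube:
  assumes "fst L < snd L" "ivl L \<subseteq> I" "x \<in> cube" shows "hat L x \<in> cube"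
proof -
  have "hat L x $ j \<in> I" for j
  proof (cases "j = 1")
    case True
    then show ?thesis
      using aff_in_ivl[OF assms(1), of "x $ 1"] assms(2,3) by (auto simp: hat_fst cube_def)
  next
    case False
    have "-1 \<le> fst L" "snd L \<le> 1"
      using assms(1,2) by (auto simp: ivl_def)
    then have "\<bar>(snd L - fst L) / 2\<bar> * \<bar>x $ j\<bar> \<le> 1 * 1"
      using assms(1,3) by (intro mult_mono) (auto simp: cube_def abs_le_iff minus_le_iff)
    then have "\<bar>(snd L - fst L) / 2 * x $ j\<bar> \<le> 1"
      by (simp add: abs_mult)
    then show ?thesis
      using False by (simp add: hat_def abs_le_iff minus_le_iff)
  qed
  then show ?thesis by (simp add: cube_def)
qed

definition shrink :: "interval \<Rightarrow> (real \<Rightarrow> real^3) \<Rightarrow> real \<Rightarrow> real^3" where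
  "shrink L f t = hat L (f (inv (aff L) t))"

lemma smooth_comp_inv_aff:
  assumes "fst L < snd L" "smooth f" shows "smooth (\<lambda>t. p + q *\<^sub>R f (inv (aff L) t))"
proof -
  obtain b where "inv (aff L) = (\<lambda>t. 2 / (snd L - fst L) * t + b)"
    using inv_aff_affine[OF assms(1)] .
  then show ?thesis
    by (simp only: smooth_affine_comp[OF assms(2)])
qed

lemma shrink_smooth:
  assumes "fst L < snd L" "smooth f" shows "smooth (shrink L f)"
  unfolding shrink_def hat_eq by (rule smooth_comp_inv_aff[OF assms])

text \<open>
  Space shrinks by the factor by which time speeds up, so velocities do not change at all.
\<close>

lemma vector_derivative_shrink:
  assumes "fst L < snd L" "smooth f"
  shows "vector_derivative (shrink L f) (at t) = vector_derivative f (at (inv (aff L) t))"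
proof -
  obtain b where b: "inv (aff L) = (\<lambda>t. 2 / (snd L - fst L) * t + b)"
    using inv_aff_affine[OF assms(1)] .
  have "(shrink L f has_vector_derivative
      ((snd L - fst L) / 2 * (2 / (snd L - fst L))) *\<^sub>R
        vector_derivative f (at (2 / (snd L - fst L) * t + b))) (at t)"
    unfolding shrink_def hat_eq b
    by (intro has_vector_derivative_affine_comp smooth_has_vector_derivative assms)
  moreover have "(snd L - fst L) / 2 * (2 / (snd L - fst L)) = 1"
    using assms(1) by simp
  ultimately show ?thesis
    by (simp only: vector_derivative_at b scaleR_one)
qed

text \<open>
  This is why rescaled knots can be inserted into the axis: beyond its interval a rescaled long
  curve already runs along the axis with unit speed.
\<close>

lemma shrink_outside:
  assumes "fst L < snd L" "\<And>t. t \<notin> I \<Longrightarrow> f t = t *\<^sub>R e1" "t \<notin> ivl L"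
  shows "shrink L f t = t *\<^sub>R e1"
  using assms inv_aff_in_I_iff[of L t] by (simp add: shrink_def hat_line aff_inv)


section \<open>Gluing along disjoint intervals\<close>

lemma C1D:
  assumes "L \<in> C1 k" "i \<in> {1..k}"
  shows "fst (L i) < snd (L i)" "ivl (L i) \<subseteq> I"
proof -
  have "L \<in> {1..k} \<rightarrow>\<^sub>E {(l, r). l < r \<and> {l..r} \<subseteq> I}"
    using assms(1) unfolding C1_def mem_Collect_eq by (rule conjunct1)
  from PiE_mem[OF this assms(2)] show "fst (L i) < snd (L i)" "ivl (L i) \<subseteq> I"
    by (auto simp: ivl_def)
qed

lemma slot_eq_Some_iff:
  assumes "L \<in> C1 k"
  shows "slot k L t = Some i \<longleftrightarrow> i \<in> {1..k} \<and> t \<in> ivl (L i)"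
proof -
  have "(THE i. i \<in> {1..k} \<and> t \<in> ivl (L i)) = i" if "i \<in> {1..k}" "t \<in> ivl (L i)" for i
  proof (rule the_equality)
    fix j assume "j \<in> {1..k} \<and> t \<in> ivl (L j)"
    then show "j = i"
      using that assms unfolding C1_def disjoint_family_on_def by blast
  qed (use that in blast)
  then show ?thesis
    by (auto simp: slot_def)
qed

lemma slot_eq_None_iff: "slot k L t = None \<longleftrightarrow> (\<forall>i\<in>{1..k}. t \<notin> ivl (L i))"
  by (auto simp: slot_def)

definition glue :: "nat \<Rightarrow> (nat \<Rightarrow> interval) \<Rightarrow> (real \<Rightarrow> 'a) \<Rightarrow> (nat \<Rightarrow> real \<Rightarrow> 'a) \<Rightarrow> real \<Rightarrow> 'a" where
  "glue k L F\<^sub>0 F t = (case slot k L t of Some i \<Rightarrow> F i t | None \<Rightarrow> F\<^sub>0 t)"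

text \<open>
  Only finitely many closed intervals miss the time \<open>t\<close>.  On the complement of their union
  the glued curve is given by a single one of its constituents, since each \<open>F i\<close> continues
  as \<open>F\<^sub>0\<close> beyond its interval.
\<close>

lemma glue_locally:
  assumes L: "L \<in> C1 k"
    and out: "\<And>i t. i \<in> {1..k} \<Longrightarrow> t \<notin> ivl (L i) \<Longrightarrow> F i t = F\<^sub>0 t"
  obtains U where "open U" "t \<in> U"
    "\<And>s. s \<in> U \<Longrightarrow> glue k L F\<^sub>0 F s = (case slot k L t of Some i \<Rightarrow> F i | None \<Rightarrow> F\<^sub>0) s"
proof
  let ?U = "- (\<Union>j\<in>{j \<in> {1..k}. t \<notin> ivl (L j)}. ivl (L j))"
  show "open ?U"
    by (intro open_Compl closed_UN) (auto simp: ivl_def)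
  show "t \<in> ?U"
    by auto
  fix s assume s: "s \<in> ?U"
  show "glue k L F\<^sub>0 F s = (case slot k L t of Some i \<Rightarrow> F i | None \<Rightarrow> F\<^sub>0) s"
  proof (cases "slot k L s")
    case None
    then have "F i s = F\<^sub>0 s" if "slot k L t = Some i" for i
      using that out by (simp add: slot_eq_None_iff slot_eq_Some_iff[OF L])
    with None show ?thesis
      by (simp add: glue_def split: option.split)
  next
    case (Some j)
    then have "slot k L t = Some j"
      using s by (auto simp: slot_eq_Some_iff[OF L])
    with Some show ?thesis
      by (simp add: glue_def)
  qed
qed

lemma smooth_glue:
  assumes L: "L \<in> C1 k"
    and out: "\<And>i t. i \<in> {1..k} \<Longrightarrow> t \<notin> ivl (L i) \<Longrightarrow> F i t = F\<^sub>0 t"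
    and sm: "smooth F\<^sub>0" "\<And>i. i \<in> {1..k} \<Longrightarrow> smooth (F i)"
  shows "smooth (glue k L F\<^sub>0 F)"
proof (rule smooth_if_locally_smooth)
  fix t
  obtain U where "open U" "t \<in> U"
    "\<And>s. s \<in> U \<Longrightarrow> glue k L F\<^sub>0 F s = (case slot k L t of Some i \<Rightarrow> F i | None \<Rightarrow> F\<^sub>0) s"
    by (rule glue_locally[OF L, where F = F and t = t]) (use out in blast)+
  moreover have "smooth (case slot k L t of Some i \<Rightarrow> F i | None \<Rightarrow> F\<^sub>0)"
    using sm by (auto simp: slot_eq_Some_iff[OF L] split: option.split)
  ultimately show "\<exists>h U. smooth h \<and> open U \<and> t \<in> U \<and> (\<forall>s\<in>U. glue k L F\<^sub>0 F s = h s)"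
    by blast
qed

lemma vector_derivative_glue:
  assumes L: "L \<in> C1 k"
    and out: "\<And>i t. i \<in> {1..k} \<Longrightarrow> t \<notin> ivl (L i) \<Longrightarrow> F i t = F\<^sub>0 t"
  shows "vector_derivative (glue k L F\<^sub>0 F) (at t) =
    (case slot k L t of Some i \<Rightarrow> vector_derivative (F i) (at t)
     | None \<Rightarrow> vector_derivative F\<^sub>0 (at t))"
proof -
  obtain U where "open U" "t \<in> U"
    "\<And>s. s \<in> U \<Longrightarrow> glue k L F\<^sub>0 F s = (case slot k L t of Some i \<Rightarrow> F i | None \<Rightarrow> F\<^sub>0) s"
    by (rule glue_locally[OF L, where F = F and t = t]) (use out in blast)+
  from vector_derivative_eq_open[OF this] show ?thesis
    by (simp split: option.split)
qed


section \<open>The action on framed knots\<close>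

lemma knot_action_glue:
  "knot_action k L K =
    (glue k L (\<lambda>t. t *\<^sub>R e1) (\<lambda>i. shrink (L i) (fst (K i))),
     glue k L (\<lambda>t. mat 1) (\<lambda>i t. snd (K i) (inv (aff (L i)) t)))"
  by (auto simp: knot_action_def glue_def shrink_def fun_eq_iff split: option.split)

lemma vector_derivative_knot_action:
  assumes L: "L \<in> C1 k" and K: "K \<in> {1..k} \<rightarrow>\<^sub>E Emb_fr"
  shows "vector_derivative (fst (knot_action k L K)) (at t) =
    (case slot k L t of Some i \<Rightarrow> vector_derivative (fst (K i)) (at (inv (aff (L i)) t))
     | None \<Rightarrow> e1)"
proof -
  have Ki: "(fst (K i), snd (K i)) \<in> Emb_fr" if "i \<in> {1..k}" for i
    using K that by auto
  note c = Emb_frD[OF Ki]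
  have line: "vector_derivative (\<lambda>t. t *\<^sub>R e1) (at t) = e1" for t
    by (rule vector_derivative_at) (auto intro!: derivative_eq_intros)
  have out: "shrink (L i) (fst (K i)) s = s *\<^sub>R e1" if "i \<in> {1..k}" "s \<notin> ivl (L i)" for i s
    using that by (intro shrink_outside C1D[OF L] c(8))
  have "vector_derivative (glue k L (\<lambda>t. t *\<^sub>R e1) (\<lambda>i. shrink (L i) (fst (K i)))) (at t) =
    (case slot k L t of Some i \<Rightarrow> vector_derivative (shrink (L i) (fst (K i))) (at t)
     | None \<Rightarrow> vector_derivative (\<lambda>t. t *\<^sub>R e1) (at t))"
    by (rule vector_derivative_glue[OF L]) (rule out)
  also have "\<dots> = (case slot k L t of
      Some i \<Rightarrow> vector_derivative (fst (K i)) (at (inv (aff (L i)) t)) | None \<Rightarrow> e1)"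
  proof (cases "slot k L t")
    case (Some i)
    then have "i \<in> {1..k}"
      by (simp add: slot_eq_Some_iff[OF L])
    with Some show ?thesis
      by (simp add: vector_derivative_shrink C1D(1)[OF L] c(1))
  qed (simp add: line)
  finally show ?thesis
    by (simp add: knot_action_glue)
qed

text \<open>
  The first coordinate of a point of the composite knot tells which interval its time lies in:
  a rescaled knot stays, during its interval, in the slab over that interval, and all other
  points are on the axis.  This makes the composite knot injective.
\<close>

lemma slot_first_coordinate:
  assumes L: "L \<in> C1 k" and K: "K \<in> {1..k} \<rightarrow>\<^sub>E Emb_fr"
  shows "slot k L (fst (knot_action k L K) t $ 1) = slot k L t"
proof (cases "slot k L t")
  case None
  then show ?thesis by (simp add: knot_action_def)
next
  case (Some i)
  then have i: "i \<in> {1..k}" "t \<in> ivl (L i)"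
    by (auto simp: slot_eq_Some_iff[OF L])
  have Ki: "(fst (K i), snd (K i)) \<in> Emb_fr"
    using K i by auto
  have "fst (K i) (inv (aff (L i)) t) \<in> cube"
    using inv_aff_in_I_iff[OF C1D(1)[OF L i(1)]] i(2) Emb_frD(4)[OF Ki] by blast
  then have "aff (L i) (fst (K i) (inv (aff (L i)) t) $ 1) \<in> ivl (L i)"
    by (intro aff_in_ivl C1D(1)[OF L i(1)]) (auto simp: cube_def)
  then have "slot k L (aff (L i) (fst (K i) (inv (aff (L i)) t) $ 1)) = Some i"
    using i by (simp add: slot_eq_Some_iff[OF L])
  with Some show ?thesis
    by (simp add: knot_action_def hat_fst)
qed

lemma knot_action_in_Emb_fr:
  assumes L: "L \<in> C1 k" and K: "K \<in> {1..k} \<rightarrow>\<^sub>E Emb_fr"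
  shows "knot_action k L K \<in> Emb_fr"
proof -
  define g where "g = fst (knot_action k L K)"
  define \<beta> where "\<beta> = snd (knot_action k L K)"
  have Ki: "(fst (K i), snd (K i)) \<in> Emb_fr" if "i \<in> {1..k}" for i
    using K that by auto
  note c = Emb_frD[OF Ki]
  have g: "g = glue k L (\<lambda>t. t *\<^sub>R e1) (\<lambda>i. shrink (L i) (fst (K i)))"
    and \<beta>: "\<beta> = glue k L (\<lambda>t. mat 1) (\<lambda>i t. snd (K i) (inv (aff (L i)) t))"
    by (simp_all add: g_def \<beta>_def knot_action_glue)
  have g_out: "g t = t *\<^sub>R e1" and \<beta>_out: "\<beta> t = mat 1" if "t \<notin> I" for t
  proof -
    have "slot k L t = None"
      using that C1D(2)[OF L] by (fastforce simp: slot_eq_None_iff)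
    then show "g t = t *\<^sub>R e1" "\<beta> t = mat 1"
      by (simp_all add: g \<beta> glue_def)
  qed
  have "smooth g"
    unfolding g
    by (intro smooth_glue[OF L] smooth_line shrink_outside shrink_smooth C1D[OF L] c)
  have "smooth \<beta>"
    unfolding \<beta>
  proof (intro smooth_glue[OF L] smooth_const)
    fix i assume i: "i \<in> {1..k}"
    note aff = C1D(1)[OF L i]
    show "smooth (\<lambda>t. snd (K i) (inv (aff (L i)) t))"
      using smooth_comp_inv_aff[OF aff c(5)[OF i], of 0 1] by simp
    show "snd (K i) (inv (aff (L i)) t) = mat 1" if "t \<notin> ivl (L i)" for t
      using that inv_aff_in_I_iff[OF aff] by (intro c(9)[OF i]) simp
  qed
  have der: "vector_derivative g (at t) =
    (case slot k L t of Some i \<Rightarrow> vector_derivative (fst (K i)) (at (inv (aff (L i)) t))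
     | None \<Rightarrow> e1)" for t
    unfolding g_def by (rule vector_derivative_knot_action[OF L K])
  then have "vector_derivative g (at t) \<noteq> 0" for t
    using c(2) by (auto simp: slot_eq_Some_iff[OF L] split: option.split)
  have "inj g"
  proof (rule injI)
    fix s t assume eq: "g s = g t"
    then have slots: "slot k L s = slot k L t"
      using slot_first_coordinate[OF L K] unfolding g_def by metis
    show "s = t"
    proof (cases "slot k L t")
      case None
      with eq slots show ?thesis
        by (simp add: g glue_def)
    next
      case (Some i)
      then have i: "i \<in> {1..k}"
        by (simp add: slot_eq_Some_iff[OF L])
      have "hat (L i) (fst (K i) (inv (aff (L i)) s)) = hat (L i) (fst (K i) (inv (aff (L i)) t))"
        using eq slots Some by (simp add: g glue_def shrink_def)
      then show ?thesis
        using C1D(1)[OF L i] c(3)[OF i] by (simp add: hat_eq_iff inv_aff_eq_iff inj_eq)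
    qed
  qed
  have "embedding_map euclidean euclidean g"
    by (rule long_curve_embedding[OF _ \<open>inj g\<close> _ g_out])
      (simp_all add: smooth_continuous_on \<open>smooth g\<close>)
  have "g t \<in> cube" if "t \<in> I" for t
  proof (cases "slot k L t")
    case None
    then show ?thesis
      using that by (auto simp: g glue_def cube_def axis_def)
  next
    case (Some i)
    then have i: "i \<in> {1..k}" "t \<in> ivl (L i)"
      by (auto simp: slot_eq_Some_iff[OF L])
    have "inv (aff (L i)) t \<in> I"
      using inv_aff_in_I_iff[OF C1D(1)[OF L i(1)]] i(2) by blast
    then have "hat (L i) (fst (K i) (inv (aff (L i)) t)) \<in> cube"
      using c(4)[OF i(1)] by (intro hat_cube C1D[OF L i(1)]) blast
    then show ?thesis
      using Some by (simp add: g glue_def shrink_def)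
  qed
  moreover have "\<beta> t \<in> O3" for t
    using c(6) by (auto simp: \<beta> glue_def O3_def orthogonal_matrix_id slot_eq_Some_iff[OF L]
        split: option.split)
  moreover have "column 1 (\<beta> t) = sgn (vector_derivative g (at t))" for t
  proof (cases "slot k L t")
    case None
    have "column 1 (mat 1) = (e1 :: real^3)"
      by (simp add: column_def mat_def axis_def vec_eq_iff)
    with None show ?thesis
      by (simp add: der \<beta> glue_def sgn_div_norm)
  next
    case (Some i)
    then have "i \<in> {1..k}"
      by (simp add: slot_eq_Some_iff[OF L])
    with Some show ?thesis
      by (simp add: der \<beta> glue_def c(7))
  qed
  ultimately have "(g, \<beta>) \<in> Emb_fr"
    using \<open>smooth g\<close> \<open>smooth \<beta>\<close> \<open>embedding_map euclidean euclidean g\<close>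
      \<open>\<And>t. vector_derivative g (at t) \<noteq> 0\<close> g_out \<beta>_out
    unfolding Emb_fr_def smooth_embedding_def by blast
  then show ?thesis
    by (simp add: g_def \<beta>_def)
qed


section \<open>Equivariance of the evaluation map\<close>

text \<open>
  Everything reduces to the times: \<open>\<kappa>\<close> inverts the affine map of an interval on that interval,
  so positions and frames agree.  For a pair of times in one interval the directions agree since
  the rescaling preserves secant directions and velocities; for two times on the axis both
  directions are \<open>e\<^sub>1\<close>, as the times increase; and if an interval contains just one of
  the two times, these are distinct and both sides are the normalized difference of positions.
\<close>

lemma ev_knot_action:
  assumes L: "L \<in> C1 k" and K: "K \<in> {1..k} \<rightarrow>\<^sub>E Emb_fr"
  shows "ev n (knot_action k L K) = AM_action n k L (\<lambda>i\<in>{1..k}. ev n (K i))"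
proof
  fix t :: "nat \<Rightarrow> real"
  let ?\<Phi> = "\<lambda>i\<in>{1..k}. ev n (K i)"
  let ?g = "fst (knot_action k L K)"
  let ?\<beta> = "snd (knot_action k L K)"
  show "ev n (knot_action k L K) t = AM_action n k L ?\<Phi> t"
  proof (cases "t \<in> simplex_n n")
    case False
    then show ?thesis by (simp add: ev_def AM_action_def split_beta)
  next
    case t: True
    have local: "ev n (K i) (kappa_simplex n (L i) t) =
        (\<lambda>a\<in>{..<n + 2}. fst (K i) (kappa (L i) (vtx n t a)),
         \<lambda>(a, b)\<in>pairs (n + 2). direction (fst (K i)) (kappa (L i) (vtx n t a)) (kappa (L i) (vtx n t b)),
         \<lambda>a\<in>{..<n + 2}. snd (K i) (kappa (L i) (vtx n t a)))"
      if i: "i \<in> {1..k}" for i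
      using i vtx_kappa_simplex[OF C1D[OF L i] t]
        ev_simps[of "kappa_simplex n (L i) t" n "fst (K i)" "snd (K i)"]
      by (auto simp: pairs_def restrict_def fun_eq_iff)
    have pos: "act_pos n k L ?\<Phi> t a = ?g (vtx n t a)"
      and frm: "(case slot k L (vtx n t a) of
            Some i \<Rightarrow> frm (?\<Phi> i (kappa_simplex n (L i) t)) a
          | None \<Rightarrow> mat 1) = ?\<beta> (vtx n t a)" if "a < n + 2" for a
    proof (atomize(full), cases "slot k L (vtx n t a)")
      case None
      then show "act_pos n k L ?\<Phi> t a = ?g (vtx n t a) \<and>
        (case slot k L (vtx n t a) of
            Some i \<Rightarrow> frm (?\<Phi> i (kappa_simplex n (L i) t)) a
          | None \<Rightarrow> mat 1) = ?\<beta> (vtx n t a)"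
        by (simp add: act_pos_def knot_action_def)
    next
      case (Some i)
      then have i: "i \<in> {1..k}" "vtx n t a \<in> ivl (L i)"
        by (auto simp: slot_eq_Some_iff[OF L])
      with Some that show "act_pos n k L ?\<Phi> t a = ?g (vtx n t a) \<and>
        (case slot k L (vtx n t a) of
            Some i \<Rightarrow> frm (?\<Phi> i (kappa_simplex n (L i) t)) a
          | None \<Rightarrow> mat 1) = ?\<beta> (vtx n t a)"
        by (simp add: act_pos_def knot_action_def local[OF i(1)] kappa_in)
    qed
    have dir: "direction ?g (vtx n t a) (vtx n t b) =
        (case (slot k L (vtx n t a), slot k L (vtx n t b)) of
            (None, None) \<Rightarrow> e1
          | (Some i, Some j) \<Rightarrow>
              if i = j then dir (?\<Phi> i (kappa_simplex n (L i) t)) (a, b)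
              else sgn (act_pos n k L ?\<Phi> t b - act_pos n k L ?\<Phi> t a)
          | _ \<Rightarrow> sgn (act_pos n k L ?\<Phi> t b - act_pos n k L ?\<Phi> t a))"
      (is "_ = ?rhs") if ab: "(a, b) \<in> pairs (n + 2)" for a b
    proof -
      let ?s = "vtx n t a" and ?t = "vtx n t b"
      have lt: "a < b" "a < n + 2" "b < n + 2"
        using ab by (auto simp: pairs_def)
      then have le: "?s \<le> ?t"
        by (intro vtx_mono[OF t]) auto
      consider "slot k L ?s \<noteq> slot k L ?t"
        | "slot k L ?s = None" "slot k L ?t = None"
        | i where "slot k L ?s = Some i" "slot k L ?t = Some i"
        by (metis option.exhaust)
      then show ?thesis
      proof cases
        case 1
        then have "direction ?g ?s ?t = sgn (?g ?t - ?g ?s)"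
          by (auto simp: direction_def)
        also have "\<dots> = sgn (act_pos n k L ?\<Phi> t b - act_pos n k L ?\<Phi> t a)"
          by (simp only: pos lt)
        also have "\<dots> = ?rhs"
          using 1 by (auto split: option.split)
        finally show ?thesis .
      next
        case 2
        have "direction ?g ?s ?t = e1"
        proof (cases "?s = ?t")
          case True
          then show ?thesis
            using 2 by (simp add: direction_def vector_derivative_knot_action[OF L K] sgn_div_norm)
        next
          case False
          have "?g ?t - ?g ?s = (?t - ?s) *\<^sub>R e1"
            using 2 by (simp add: knot_action_def scaleR_diff_left)
          then show ?thesis
            using False le by (simp add: direction_def sgn_scaleR) (simp add: sgn_div_norm)
        qed
        with 2 show ?thesis by simp
      next
        case (3 i)
        then have i: "i \<in> {1..k}" "?s \<in> ivl (L i)" "?t \<in> ivl (L i)"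
          by (auto simp: slot_eq_Some_iff[OF L])
        note aff = C1D(1)[OF L i(1)]
        have "direction ?g ?s ?t = direction (fst (K i)) (inv (aff (L i)) ?s) (inv (aff (L i)) ?t)"
        proof (cases "?s = ?t")
          case True
          then show ?thesis
            using 3 by (simp add: direction_def vector_derivative_knot_action[OF L K])
        next
          case False
          then show ?thesis
            using 3 by (simp add: direction_def inv_aff_eq_iff[OF aff] knot_action_def
                sgn_hat_diff[OF aff])
        qed
        then show ?thesis
          using 3 ab i by (simp add: local[OF i(1)] kappa_in)
      qed
    qed
    have "ev n (knot_action k L K) t = ev n (?g, ?\<beta>) t"
      by simp
    also have "\<dots> = AM_action n k L ?\<Phi> t"
      unfolding ev_simps[OF t] AM_action_def restrict_apply'[OF t]
    proof (intro prod_eqI; simp only: fst_conv snd_conv; intro restrict_ext)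
      show "?g (vtx n t a) = act_pos n k L ?\<Phi> t a" if "a \<in> {..<n + 2}" for a
        using that pos by simp
      show "?\<beta> (vtx n t a) = (case slot k L (vtx n t a) of
            Some i \<Rightarrow> frm (?\<Phi> i (kappa_simplex n (L i) t)) a
          | None \<Rightarrow> mat 1)" if "a \<in> {..<n + 2}" for a
        using that frm by simp
    next
      fix p assume "p \<in> pairs (n + 2)"
      with dir[of "fst p" "snd p"]
      show "(case p of (a, b) \<Rightarrow> direction ?g (vtx n t a) (vtx n t b)) =
        (case p of (a, b) \<Rightarrow>
          (case (slot k L (vtx n t a), slot k L (vtx n t b)) of
            (None, None) \<Rightarrow> e1
          | (Some i, Some j) \<Rightarrow>
              if i = j then dir (?\<Phi> i (kappa_simplex n (L i) t)) (a, b)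
              else sgn (act_pos n k L ?\<Phi> t b - act_pos n k L ?\<Phi> t a)
          | _ \<Rightarrow> sgn (act_pos n k L ?\<Phi> t b - act_pos n k L ?\<Phi> t a)))"
        by (simp only: split_beta prod.collapse)
    qed
    finally show ?thesis .
  qed
qed

theorem proposition4p4:
  fixes n :: nat
  shows "ev n \<in> Emb_fr \<rightarrow> AM_fr n \<and>
    (\<forall>k. \<forall>L\<in>C1 k. \<forall>K\<in>{1..k} \<rightarrow>\<^sub>E Emb_fr.
       knot_action k L K \<in> Emb_fr \<and>
       ev n (knot_action k L K) = AM_action n k L (\<lambda>i\<in>{1..k}. ev n (K i)))"
  using ev_in_AM_fr knot_action_in_Emb_fr ev_knot_action by blast

end
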